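(* Let $N\ge 2$, let $\varSigma=(\sigma_i)_{i=1}^N$ be a finite ensemble (sequence) of parameters, let $\mathcal A_{\sigma_i}\in\mathbb R^{n\times n}$ for $1\le i\le N$, and let $B\in\mathbb R^{n\times m}$. (1) If the ensemble of systems $(\mathcal A_{\sigma_i},B)_{i=1}^N$ is ensemble stabilizable, then for every $1\le i\le N$ the system $(\mathcal A_{\sigma_i},B)$ is stabilizable, and $$\bigcup_{\substack{\mathcal I\subseteq\{1,\ldots,N\}\\ \#\mathcal I=m+1}}\ \bigcap_{j\in\mathcal I}\mathrm{Eig}_{\ge 0}(\mathcal A_{\sigma_j})=\emptyset .$$ (2) Reciprocally, if for each $1\le i\le N$ the system $(\mathcal A_{\sigma_i},B)$ is stabilizable and $$\mathrm{Eig}_{\ge 0}(\mathcal A_{\sigma_i})\cap\mathrm{Eig}_{\ge 0}(\mathcal A_{\sigma_j})=\emptyset\quad\text{for all } i\neq j,\ 1\le i,j\le N,$$ then the ensemble of systems $(\mathcal A_{\sigma_i},B)_{i=1}^N$ is ensemble stabilizable.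
   Context: For a real square matrix $A$, $\mathrm{Eig}(A)\subset\mathbb C$ is its set of eigenvalues and $\mathrm{Eig}_{\ge 0}(A)=\{\lambda\in\mathrm{Eig}(A)\mid \mathrm{Re}(\lambda)\ge 0\}$. A real square matrix $A$ is called stable if $\mathrm{Eig}_{\ge0}(A)=\emptyset$. A pair $(A,B)$ of real matrices ($A\in\mathbb R^{d\times d}$, $B\in\mathbb R^{d\times m}$) is stabilizable if there exists $K\in\mathbb R^{m\times d}$ such that $A+BK$ is stable. The ensemble $(\mathcal A_{\sigma_i},B)_{i=1}^N$ is called ensemble stabilizable if the pair $(\mathbf A_\varSigma,\mathbf B)$ is stabilizable, where $\mathbf A_\varSigma\in\mathbb R^{nN\times nN}$ is the block-diagonal matrix with diagonal blocks $\mathcal A_{\sigma_1},\ldots,\mathcal A_{\sigma_N}$ and $\mathbf B=\begin{bmatrix}B^\top&B^\top&\cdots&B^\top\end{bmatrix}^\top\in\mathbb R^{nN\times m}$ ($N$ copies of $B$ stacked). $\#\mathcal I$ denotes the cardinality of $\mathcal I$. *)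

theory Defs
  imports "Jordan_Normal_Form.Spectral_Radius"
begin

definition Eig :: "real mat \<Rightarrow> complex set" where
  "Eig A = spectrum (map_mat complex_of_real A)"

definition Eig_nonneg :: "real mat \<Rightarrow> complex set" where
  "Eig_nonneg A = {z \<in> Eig A. Re z \<ge> 0}"

definition stable_mat :: "real mat \<Rightarrow> bool" where
  "stable_mat A \<longleftrightarrow> Eig_nonneg A = {}"

(* Meaningful for A in carrier_mat d d and B in carrier_mat d m, so that K ranges over
   the real m x d matrices. *)
definition stabilizable :: "real mat \<Rightarrow> real mat \<Rightarrow> bool" where
  "stabilizable A B \<longleftrightarrow>
     (\<exists>K \<in> carrier_mat (dim_col B) (dim_row A). stable_mat (A + B * K))"

definition stack_copies :: "nat \<Rightarrow> 'a mat \<Rightarrow> 'a mat" where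
  "stack_copies N B = mat_of_rows (dim_col B) (concat (replicate N (rows B)))"

(* The ensemble (A_1, B), ..., (A_N, B) is given by the list [A_1, ..., A_N] and B. *)
definition ensemble_stabilizable :: "real mat list \<Rightarrow> real mat \<Rightarrow> bool" where
  "ensemble_stabilizable As B \<longleftrightarrow>
     stabilizable (diag_block_mat As) (stack_copies (length As) B)"

end

theory Submission
  imports Defs
begin

text \<open>
  By the Hautus test, a pair $(A, B)$ is stabilizable iff no left eigenvector of $A$ for an
  eigenvalue in the closed right half-plane annihilates $B$. A left eigenvector of the ensemble
  is a tuple of left eigenvectors (or zeros) of the members for a common eigenvalue, and it
  annihilates the stacked input matrix iff the sum of the products of its components with $B$
  vanishes. So $m + 1$ members sharing an unstable eigenvalue give $m + 1$ linearly dependent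
  vectors in $\<complex>^m$ and hence an obstruction, while disjoint unstable spectra leave at most one
  nonzero component.

  For the hard half of the Hautus test, let the rows of $L$ be the real and imaginary parts of an
  unstable left eigenvector (one of them suffices for a real eigenvalue), so that $LA = ML$ with
  $M$ of size at most $2$. A feedback $K = GL$ replaces the eigenvalues of $M$ by those of
  $M + LBG$ and keeps all others. Choosing $G$ so that $M + LBG$ is stable decreases the number of
  unstable eigenvalues of $A$, counted with multiplicity.
\<close>

subsection \<open>Spectra under feedback along a left invariant subspace\<close>

text \<open>Both sides are the determinant of the product of the block matrices
  $[[I, 0], [-W, Q]]$ and $[[P, U], [W, I]]$.\<close>
lemma det_intertwining:
  fixes P U W Q :: "'a :: idom mat"
  assumes P: "P \<in> carrier_mat n n" and U: "U \<in> carrier_mat n k"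
    and W: "W \<in> carrier_mat k n" and Q: "Q \<in> carrier_mat k k"
    and WP: "W * P = Q * W"
  shows "det Q * det (P - U * W) = det P * det (Q - W * U)"
proof -
  let ?S = "four_block_mat P U W (1\<^sub>m k)"
  let ?L = "four_block_mat (1\<^sub>m n) (0\<^sub>m n k) (- W) Q"
  let ?R = "four_block_mat (1\<^sub>m n) (0\<^sub>m n k) (- W) (1\<^sub>m k)"
  have UW: "U * W \<in> carrier_mat n n" and WU: "W * U \<in> carrier_mat k k"
    and QW: "Q * W \<in> carrier_mat k n" using P U W Q by auto
  have cS: "?S \<in> carrier_mat (n+k) (n+k)" and cL: "?L \<in> carrier_mat (n+k) (n+k)"
    and cR: "?R \<in> carrier_mat (n+k) (n+k)"
    using P U W Q by auto
  \<comment> \<open>Right multiplication by \<open>?R\<close>, of determinant 1, clears the lower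
    left block of \<open>?S\<close>.\<close>
  have SR: "?S * ?R = four_block_mat (P - U * W) U (0\<^sub>m k n) (1\<^sub>m k)"
    by (subst mult_four_block_mat[OF P U W one_carrier_mat one_carrier_mat zero_carrier_mat _ one_carrier_mat])
      (use P U W UW in \<open>auto intro!: arg_cong2[of _ _ _ _ "\<lambda>x y. four_block_mat x U y (1\<^sub>m k)"]
         simp: minus_add_uminus_mat[OF P UW] uminus_l_inv_mat[OF W]\<close>)
  \<comment> \<open>The lower left block is \<open>Q * W - W * P\<close>, which vanishes by
    \<open>WP\<close>.\<close>
  have LS: "?L * ?S = four_block_mat P U (0\<^sub>m k n) (Q - W * U)"
    by (subst mult_four_block_mat[OF one_carrier_mat zero_carrier_mat _ Q P U W one_carrier_mat])
      (use P U W Q UW WU QW in \<open>auto intro!: arg_cong2[of _ _ _ _ "four_block_mat P U"]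
         simp: WP minus_add_uminus_mat[OF Q WU] uminus_l_inv_mat comm_add_mat[OF _ Q]\<close>)
  have dS: "det ?S = det (P - U * W)"
  proof -
    have "det ?S = det (?S * ?R)"
      using P U W by (simp add: det_mult[OF cS cR] det_four_block_mat_upper_right_zero[of _ n _ k])
    also have "\<dots> = det (P - U * W)"
      unfolding SR using P U W
      by (subst det_four_block_mat_lower_left_zero[of _ n _ k]) auto
    finally show ?thesis .
  qed
  have "det Q * det ?S = det (?L * ?S)"
    using P U W Q by (simp add: det_mult[OF cL cS] det_four_block_mat_upper_right_zero[of _ n _ k])
  also have "\<dots> = det P * det (Q - W * U)"
    unfolding LS using P U W Q by (intro det_four_block_mat_lower_left_zero) auto
  finally show ?thesis unfolding dS .
qed

text \<open>This is \<open>det_intertwining\<close> over the polynomial ring, applied to the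
  characteristic matrices of \<open>A\<close> and \<open>M\<close>. They are intertwined by
  \<open>L\<close> because \<open>L\<close> commutes with multiplication by the
  indeterminate.\<close>

lemma char_poly_intertwining:
  fixes A U L M :: "'a :: idom mat"
  assumes A: "A \<in> carrier_mat n n" and U: "U \<in> carrier_mat n k"
    and L: "L \<in> carrier_mat k n" and M: "M \<in> carrier_mat k k"
    and LA: "L * A = M * L"
  shows "char_poly M * char_poly (A + U * L) = char_poly A * char_poly (M + L * U)"
proof -
  interpret comm_ring_hom "\<lambda>a :: 'a. [:a:]"
    by unfold_locales auto
  let ?c = "map_mat (\<lambda>a :: 'a. [:a:])"
  let ?x = "[:0, 1:] :: 'a poly"
  have cp: "char_poly_matrix X = ?x \<cdot>\<^sub>m 1\<^sub>m r - ?c X" if "X \<in> carrier_mat r r" for X r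
    using that unfolding char_poly_matrix_def by (intro eq_matI) auto
  \<comment> \<open>Brings both \<open>A + U * L\<close> and \<open>M + L * U\<close> into the shape
    required by \<open>det_intertwining\<close>, with the roles of \<open>U\<close> and
    \<open>L\<close> exchanged.\<close>
  have sp: "char_poly_matrix (X + Y * Z) = char_poly_matrix X - ?c Y * ?c Z"
    if "X \<in> carrier_mat r r" "Y \<in> carrier_mat r s" "Z \<in> carrier_mat s r" for X Y Z r s
    using that unfolding mat_hom_mult[OF that(2,3), symmetric]
    by (intro eq_matI) (auto simp: char_poly_matrix_def)
  have "?c L * char_poly_matrix A = ?x \<cdot>\<^sub>m ?c L - ?c L * ?c A"
    unfolding cp[OF A] by (subst mult_minus_distrib_mat[of _ k n]) (use A L in auto)
  also have "?c L * ?c A = ?c M * ?c L"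
    using A L M LA by (metis mat_hom_mult)
  also have "?x \<cdot>\<^sub>m ?c L - ?c M * ?c L = char_poly_matrix M * ?c L"
    unfolding cp[OF M] by (subst minus_mult_distrib_mat[of _ k k]) (use M L in auto)
  finally have "?c L * char_poly_matrix A = char_poly_matrix M * ?c L" .
  then show ?thesis
    unfolding char_poly_def sp[OF A U L] sp[OF M L U]
    by (intro det_intertwining) (use A U L M in auto)
qed

section \<open>Unstable eigenvalues counted with multiplicity\<close>

abbreviation cmat :: "real mat \<Rightarrow> complex mat" where
  "cmat \<equiv> map_mat complex_of_real"

text \<open>Roots are kept with algebraic multiplicity, so that products of characteristic
  polynomials turn into sums of counts. This is the measure of the induction over feedbacks.\<close>

definition unstable_count :: "real mat \<Rightarrow> nat" where
  "unstable_count A = size (filter_mset (\<lambda>z. Re z \<ge> 0) (proots (char_poly (cmat A))))"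

lemma char_poly_neq_0:
  fixes A :: "'a :: idom mat"
  assumes "A \<in> carrier_mat n n"
  shows "char_poly A \<noteq> 0"
  using degree_monic_char_poly[OF assms] by auto

lemma Eig_iff_root:
  assumes "A \<in> carrier_mat n n"
  shows "z \<in> Eig A \<longleftrightarrow> poly (char_poly (cmat A)) z = 0"
  unfolding Eig_def using spectrum_root_char_poly[of "cmat A" n] assms by auto

lemma unstable_count_eq_0_iff:
  assumes A: "A \<in> carrier_mat n n"
  shows "unstable_count A = 0 \<longleftrightarrow> stable_mat A"
  unfolding unstable_count_def stable_mat_def Eig_nonneg_def
  using Eig_iff_root[OF A] char_poly_neq_0[of "cmat A" n] A
  by auto

text \<open>The roots of a product of nonzero polynomials form the multiset sum of the roots of the
  factors; filtering and taking sizes respect this sum.\<close>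

lemma unstable_count_intertwining:
  assumes A: "A \<in> carrier_mat n n" and U: "U \<in> carrier_mat n k"
    and L: "L \<in> carrier_mat k n" and M: "M \<in> carrier_mat k k"
    and LA: "L * A = M * L"
  shows "unstable_count M + unstable_count (A + U * L) = unstable_count A + unstable_count (M + L * U)"
proof -
  interpret h: map_poly_comm_ring_hom complex_of_real ..
  have UL: "A + U * L \<in> carrier_mat n n" and LU: "M + L * U \<in> carrier_mat k k"
    using A U L M by auto
  have "char_poly (cmat M) * char_poly (cmat (A + U * L)) = char_poly (cmat A) * char_poly (cmat (M + L * U))"
    using arg_cong[OF char_poly_intertwining[OF A U L M LA], of "map_poly complex_of_real"]
    by (simp add: of_real_hom.char_poly_hom[OF A] of_real_hom.char_poly_hom[OF M]
        of_real_hom.char_poly_hom[OF UL] of_real_hom.char_poly_hom[OF LU] h.hom_mult)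
  then have "proots (char_poly (cmat M)) + proots (char_poly (cmat (A + U * L)))
      = proots (char_poly (cmat A)) + proots (char_poly (cmat (M + L * U)))"
    using A M UL LU by (metis char_poly_neq_0 map_carrier_mat proots_mult)
  then show ?thesis
    unfolding unstable_count_def by (metis filter_union_mset size_union)
qed

subsection \<open>The Hautus test\<close>

text \<open>This is the condition that \<open>[A - z I, B]\<close> has full row rank for all
  \<open>z\<close> in the closed right half-plane. A vector \<open>w\<close> stands for the row
  vector given by its plain, unconjugated transpose.\<close>

definition hautus :: "real mat \<Rightarrow> real mat \<Rightarrow> bool" where
  "hautus A B \<longleftrightarrow> (\<forall>z w. Re z \<ge> 0 \<longrightarrow> w \<in> carrier_vec (dim_row A) \<longrightarrow>
     transpose_mat (cmat A) *\<^sub>v w = z \<cdot>\<^sub>v w \<longrightarrow>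
     transpose_mat (cmat B) *\<^sub>v w = 0\<^sub>v (dim_col B) \<longrightarrow> w = 0\<^sub>v (dim_row A))"

lemma hautusD:
  assumes "hautus A B" "A \<in> carrier_mat n n" "B \<in> carrier_mat n m" "Re z \<ge> 0" "w \<in> carrier_vec n"
    "transpose_mat (cmat A) *\<^sub>v w = z \<cdot>\<^sub>v w" "transpose_mat (cmat B) *\<^sub>v w = 0\<^sub>v m"
  shows "w = 0\<^sub>v n"
  using assms unfolding hautus_def by auto

text \<open>A matrix and its transpose have the same characteristic polynomial.\<close>

lemma Eig_iff_left_eigenvector:
  assumes A: "A \<in> carrier_mat n n"
  shows "z \<in> Eig A \<longleftrightarrow> (\<exists>w \<in> carrier_vec n. w \<noteq> 0\<^sub>v n \<and> transpose_mat (cmat A) *\<^sub>v w = z \<cdot>\<^sub>v w)"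
proof -
  have c: "cmat A \<in> carrier_mat n n" "transpose_mat (cmat A) \<in> carrier_mat n n" using A by auto
  show ?thesis
    using A unfolding Eig_iff_root[OF A] char_poly_transpose_mat[OF c(1), symmetric]
      eigenvalue_root_char_poly[OF c(2), symmetric]
    by (auto simp: eigenvalue_def eigenvector_def)
qed

text \<open>A row vector that annihilates \<open>B\<close> annihilates \<open>B * K\<close> too, so
  the feedback is invisible to it.\<close>

lemma transpose_feedback_mult_vec:
  assumes A: "A \<in> carrier_mat n n" and B: "B \<in> carrier_mat n m" and K: "K \<in> carrier_mat m n"
    and w: "w \<in> carrier_vec n" and Bw: "transpose_mat (cmat B) *\<^sub>v w = 0\<^sub>v m"
  shows "transpose_mat (cmat (A + B * K)) *\<^sub>v w = transpose_mat (cmat A) *\<^sub>v w"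
proof -
  have "cmat (A + B * K) = cmat A + cmat B * cmat K"
    unfolding of_real_hom.mat_hom_mult[OF B K, symmetric] using A B K 
    by (intro eq_matI) (auto)
  then have "transpose_mat (cmat (A + B * K)) = 
      transpose_mat (cmat A) + transpose_mat (cmat K) * transpose_mat (cmat B)"
    using A B K by (simp add: transpose_add[of _ n n] transpose_mult[of _ n m _ n])
  moreover have "(transpose_mat (cmat K) * transpose_mat (cmat B)) *\<^sub>v w = 0\<^sub>v n"
    using A B K w Bw by (subst assoc_mult_mat_vec[of _ n m _ n]) auto
  ultimately show ?thesis
    using A B K w by (auto simp: add_mult_distrib_mat_vec[of _ n n])
qed

text \<open>A left eigenvector that annihilates \<open>B\<close> survives every feedback with its
  eigenvalue, so an unstable one would rule out stabilization.\<close>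

lemma stabilizable_imp_hautus:
  assumes A: "A \<in> carrier_mat n n" and B: "B \<in> carrier_mat n m" and s: "stabilizable A B"
  shows "hautus A B"
proof -
  obtain K where K: "K \<in> carrier_mat m n" and st: "stable_mat (A + B * K)"
    using s A B unfolding stabilizable_def by auto
  have AK: "A + B * K \<in> carrier_mat n n" using A B K by auto
  show ?thesis
    using st A B Eig_iff_left_eigenvector[OF AK] transpose_feedback_mult_vec[OF A B K]
    unfolding hautus_def stable_mat_def Eig_nonneg_def by fastforce
qed

text \<open>Lets the induction continue with \<open>A + B * K\<close>: among the vectors
  annihilating \<open>B\<close>, the left eigenvectors and their eigenvalues stay the same.\<close>

lemma hautus_feedback:
  assumes A: "A \<in> carrier_mat n n" and B: "B \<in> carrier_mat n m" and K: "K \<in> carrier_mat m n"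
    and h: "hautus A B"
  shows "hautus (A + B * K) B"
  using h A B K transpose_feedback_mult_vec[OF A B K] unfolding hautus_def by auto

lemma map_vec_Re_cmat_mult:
  assumes "X \<in> carrier_mat k n" "w \<in> carrier_vec n"
  shows "map_vec Re (cmat X *\<^sub>v w) = X *\<^sub>v map_vec Re w"
  using assms by (intro eq_vecI) (auto simp: scalar_prod_def)

lemma map_vec_Im_cmat_mult:
  assumes "X \<in> carrier_mat k n" "w \<in> carrier_vec n"
  shows "map_vec Im (cmat X *\<^sub>v w) = X *\<^sub>v map_vec Im w"
  using assms by (intro eq_vecI) (auto simp: scalar_prod_def)

text \<open>Expresses \<open>L * A\<close> by the transpose of \<open>A\<close> acting on the rows
  of \<open>L\<close>, the form in which left eigenvectors enter.\<close>

lemma mat_of_rows_mult: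
  fixes X :: "'a :: comm_semiring_0 mat"
  assumes "X \<in> carrier_mat n m" "set us \<subseteq> carrier_vec n"
  shows "mat_of_rows n us * X = mat_of_rows m (map (\<lambda>u. transpose_mat X *\<^sub>v u) us)"
  using assms
  by (intro eq_matI) (auto simp: subset_iff mat_of_rows_index intro!: comm_scalar_prod[of _ n])

section \<open>Stability of matrices of size one and two\<close>

lemma stable_mat_1:
  assumes M: "M \<in> carrier_mat 1 1" and neg: "M $$ (0,0) < 0"
  shows "stable_mat M"
proof -
  have "Re z < 0" if ev: "z \<in> Eig M" for z
  proof -
    obtain w where w: "w \<in> carrier_vec 1" "w \<noteq> 0\<^sub>v 1" "transpose_mat (cmat M) *\<^sub>v w = z \<cdot>\<^sub>v w"
      using ev unfolding Eig_iff_left_eigenvector[OF M] by blast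
    have "of_real (M $$ (0,0)) * w $ 0 = z * w $ 0"
      using arg_cong[OF w(3), of "\<lambda>v. v $ 0"] w(1) M by (simp add: scalar_prod_def)
    moreover have "w $ 0 \<noteq> 0" using w(1,2) by (auto simp: vec_eq_iff)
    ultimately show ?thesis using neg by auto
  qed
  then show ?thesis unfolding stable_mat_def Eig_nonneg_def by force
qed

text \<open>The Routh-Hurwitz criterion in degree two. An eigenvalue solves
  \<open>z * z - T * z + D = 0\<close> with trace \<open>T\<close> and determinant \<open>D\<close>.
  If it is not real, its real part is \<open>T / 2\<close>; if it were real and nonnegative, the
  left-hand side would be positive.\<close>

lemma stable_mat_2:
  assumes M: "M \<in> carrier_mat 2 2"
    and tr: "M $$ (0,0) + M $$ (1,1) < 0"
    and dt: "M $$ (0,0) * M $$ (1,1) - M $$ (0,1) * M $$ (1,0) > 0"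
  shows "stable_mat M"
proof -
  have "Re z < 0" if ev: "z \<in> Eig M" for z
  proof -
    obtain w where w: "w \<in> carrier_vec 2" "w \<noteq> 0\<^sub>v 2" "transpose_mat (cmat M) *\<^sub>v w = z \<cdot>\<^sub>v w"
      using ev unfolding Eig_iff_left_eigenvector[OF M] by blast
    define a b c d where "a = complex_of_real (M $$ (0,0))" and "b = complex_of_real (M $$ (0,1))"
      and "c = complex_of_real (M $$ (1,0))" and "d = complex_of_real (M $$ (1,1))"
    have 1: "a * w $ 0 + c * w $ 1 = z * w $ 0" and 2: "b * w $ 0 + d * w $ 1 = z * w $ 1"
      using arg_cong[OF w(3), of "\<lambda>v. v $ 0"] arg_cong[OF w(3), of "\<lambda>v. v $ 1"] w(1) M
      by (simp_all add: scalar_prod_def numeral_2_eq_2 a_def b_def c_def d_def)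
    have "w $ 0 \<noteq> 0 \<or> w $ 1 \<noteq> 0"
    proof (rule ccontr)
      assume "\<not> ?thesis"
      then have "w = 0\<^sub>v 2" using w(1) by (intro eq_vecI) (auto simp: less_2_cases_iff)
      with w(2) show False ..
    qed
    moreover have "(z - a) * w $ 0 = c * w $ 1" and "(z - d) * w $ 1 = b * w $ 0"
      using 1 2 by (simp_all add: algebra_simps)
    \<comment> \<open>Substituting either equation into the other decouples the coordinates; a
      nonzero one can then be cancelled.\<close>
    then have "((z - a) * (z - d)) * w $ 0 = (b * c) * w $ 0" "((z - a) * (z - d)) * w $ 1 = (b * c) * w $ 1"
      by (metis mult.assoc mult.commute)+
    ultimately have char: "(z - a) * (z - d) = b * c" by auto
    define T D where "T = M $$ (0,0) + M $$ (1,1)" and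
      "D = M $$ (0,0) * M $$ (1,1) - M $$ (0,1) * M $$ (1,0)"
    have TD: "of_real T = a + d" "of_real D = a * d - b * c"
      by (simp_all add: T_def D_def a_def b_def c_def d_def)
    have eq: "z * z - of_real T * z + of_real D = 0"
      unfolding TD using char by (simp add: algebra_simps)
    have re: "Re z * Re z - Im z * Im z - T * Re z + D = 0" and im: "(2 * Re z - T) * Im z = 0"
      using arg_cong[OF eq, of Re] arg_cong[OF eq, of Im] by (simp_all add: algebra_simps)
    have T: "T < 0" and D: "D > 0" using tr dt by (simp_all add: T_def D_def)
    show ?thesis
    proof (cases "Im z = 0")
      case True
      show ?thesis
      proof (rule ccontr)
        assume "\<not> Re z < 0"
        then have "Re z * Re z \<ge> 0" "- T * Re z \<ge> 0" using T by (simp_all add: mult_nonpos_nonneg)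
        with re True D show False by simp
      qed
    qed (use im T in auto)
  qed
  then show ?thesis unfolding stable_mat_def Eig_nonneg_def by force
qed

section \<open>Lowering the unstable count by feedback\<close>

text \<open>With \<open>U = B * G\<close>, the last term of the counting identity is 0 by stability
  of \<open>M + L * B * G\<close>, while the count of \<open>M\<close> is positive. The feedback is
  \<open>G * L\<close>.\<close>

lemma unstable_count_decrease:
  assumes A: "A \<in> carrier_mat n n" and B: "B \<in> carrier_mat n m"
    and L: "L \<in> carrier_mat k n" and M: "M \<in> carrier_mat k k" and LA: "L * A = M * L"
    and G: "G \<in> carrier_mat m k" and unst: "\<not> stable_mat M" and st: "stable_mat (M + L * B * G)"
  shows "\<exists>K \<in> carrier_mat m n. unstable_count (A + B * K) < unstable_count A"
proof
  have "unstable_count M + unstable_count (A + (B * G) * L) = unstable_count A + unstable_count (M + L * (B * G))"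
    using unstable_count_intertwining[OF A _ L M LA] B G by auto
  moreover have "(B * G) * L = B * (G * L)" and "L * (B * G) = L * B * G" using B G L by auto
  moreover have "unstable_count (M + L * B * G) = 0"
    using unstable_count_eq_0_iff[of "M + L * B * G" k] M L B G st by auto
  moreover have "unstable_count M \<noteq> 0" using unstable_count_eq_0_iff[OF M] unst by simp
  ultimately show "unstable_count (A + B * (G * L)) < unstable_count A" by simp
  show "G * L \<in> carrier_mat m n" using G L by auto
qed

lemma scalar_prod_self_pos:
  fixes x :: "real vec"
  assumes x: "x \<in> carrier_vec m" "x \<noteq> 0\<^sub>v m"
  shows "x \<bullet> x > 0"
proof -
  obtain i where "i < m" "x $ i \<noteq> 0" using x by (auto simp: vec_eq_iff)
  then have "0 < (\<Sum>i = 0..<m. x $ i * x $ i)"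
    by (intro sum_pos2[of _ i]) (auto simp: less_le)
  then show ?thesis using x by (simp add: scalar_prod_def)
qed

lemma real_cauchy_schwarz_vec:
  fixes x y :: "real vec"
  assumes x: "x \<in> carrier_vec m" and y: "y \<in> carrier_vec m"
  shows "(x \<bullet> y)\<^sup>2 \<le> (x \<bullet> x) * (y \<bullet> y)"
proof (cases "y = 0\<^sub>v m")
  case False
  \<comment> \<open>This is the component of \<open>x\<close> orthogonal to \<open>y\<close>, scaled
    by \<open>y \<bullet> y\<close> to avoid a division.\<close>
  let ?z = "(y \<bullet> y) \<cdot>\<^sub>v x - (x \<bullet> y) \<cdot>\<^sub>v y"
  have "?z \<bullet> ?z = (y \<bullet> y) * ((x \<bullet> x) * (y \<bullet> y) - (x \<bullet> y)\<^sup>2)"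
    using x y comm_scalar_prod[OF y x]
    by (simp add: scalar_prod_minus_distrib[of _ m] minus_scalar_prod_distrib[of _ m]
        power2_eq_square algebra_simps)
  moreover have "?z \<bullet> ?z \<ge> 0" by (auto simp: scalar_prod_def intro!: sum_nonneg)
  ultimately show ?thesis
    using scalar_prod_self_pos[OF y False] by (simp add: zero_le_mult_iff)
qed (use x in simp)

text \<open>The Hautus condition makes the rows of \<open>L * B\<close> not all zero, so the columns
  of \<open>G\<close> can be built from these rows. The case distinction is on whether the unstable
  eigenvalue is real.\<close>

lemma feedback_decreasing_unstable_count:
  assumes A: "A \<in> carrier_mat n n" and B: "B \<in> carrier_mat n m"
    and h: "hautus A B" and unst: "\<not> stable_mat A"
  shows "\<exists>K \<in> carrier_mat m n. unstable_count (A + B * K) < unstable_count A"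
proof -
  have A': "transpose_mat A \<in> carrier_mat n n" and B': "transpose_mat B \<in> carrier_mat m n"
    using A B by auto
  have cA: "transpose_mat (cmat A) = cmat (transpose_mat A)" 
    and cB: "transpose_mat (cmat B) = cmat (transpose_mat B)"
    by (simp_all add: map_mat_transpose)
  obtain z w where z: "Re z \<ge> 0" and w: "w \<in> carrier_vec n" "w \<noteq> 0\<^sub>v n"
    and ev: "cmat (transpose_mat A) *\<^sub>v w = z \<cdot>\<^sub>v w"
    using unst Eig_iff_left_eigenvector[OF A] unfolding stable_mat_def Eig_nonneg_def cA by blast
  define u v a b where "u = map_vec Re w" and "v = map_vec Im w" and "a = Re z" and "b = Im z"
  have uv: "u \<in> carrier_vec n" "v \<in> carrier_vec n" unfolding u_def v_def using w by auto
  have w_eq: "w = map_vec complex_of_real u + \<i> \<cdot>\<^sub>v map_vec complex_of_real v"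
    using w by (intro eq_vecI) (auto simp: u_def v_def complex_eq_iff)
  \<comment> \<open>Real and imaginary parts of the eigenvector equation for
    \<open>w = u + i v\<close> and \<open>z = a + i b\<close>.\<close>
  have Au: "transpose_mat A *\<^sub>v u = a \<cdot>\<^sub>v u - b \<cdot>\<^sub>v v"
    unfolding u_def map_vec_Re_cmat_mult[OF A' w(1), symmetric] ev
    using w by (intro eq_vecI) (auto simp: v_def a_def b_def)
  have Av: "transpose_mat A *\<^sub>v v = b \<cdot>\<^sub>v u + a \<cdot>\<^sub>v v"
    unfolding v_def map_vec_Im_cmat_mult[OF A' w(1), symmetric] ev
    using w by (intro eq_vecI) (auto simp: u_def a_def b_def)
  show ?thesis
  proof (cases "b = 0")
    case True
    have "u \<noteq> 0\<^sub>v n \<or> v \<noteq> 0\<^sub>v n" using w w_eq by auto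
    \<comment> \<open>For a real eigenvalue, \<open>u\<close> and \<open>v\<close> each satisfy the
      eigenvector equation; \<open>x\<close> is one that is nonzero.\<close>
    then obtain x where x: "x \<in> carrier_vec n" "x \<noteq> 0\<^sub>v n" and Ax: "transpose_mat A *\<^sub>v x = a \<cdot>\<^sub>v x"
    proof -
      have "transpose_mat A *\<^sub>v u = a \<cdot>\<^sub>v u" "transpose_mat A *\<^sub>v v = a \<cdot>\<^sub>v v"
        unfolding Au Av True using uv by (auto intro!: eq_vecI)
      then show ?thesis using that uv \<open>u \<noteq> 0\<^sub>v n \<or> v \<noteq> 0\<^sub>v n\<close> by blast
    qed
    define \<beta> where "\<beta> = transpose_mat B *\<^sub>v x"
    have \<beta>: "\<beta> \<in> carrier_vec m" using B x by (auto simp: \<beta>_def)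
    have "\<beta> \<noteq> 0\<^sub>v m"
    proof
      assume "\<beta> = 0\<^sub>v m"
      then have "cmat (transpose_mat B) *\<^sub>v map_vec complex_of_real x = 0\<^sub>v m"
        unfolding \<beta>_def of_real_hom.mult_mat_vec_hom[OF B' x(1), symmetric] by auto
      moreover have "cmat (transpose_mat A) *\<^sub>v map_vec complex_of_real x = of_real a \<cdot>\<^sub>v map_vec complex_of_real x"
        unfolding of_real_hom.mult_mat_vec_hom[OF A' x(1), symmetric] Ax 
        by (simp add: of_real_hom.vec_hom_smult)
      ultimately have "map_vec complex_of_real x = 0\<^sub>v n"
        using x z by (intro hautusD[OF h A B, of "of_real a"]) (auto simp: cA cB a_def)
      then show False using x by (auto simp: vec_eq_iff)
    qed
    then have p: "\<beta> \<bullet> \<beta> > 0" using \<beta> scalar_prod_self_pos by blast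
    let ?L = "mat_of_rows n [x]" and ?M = "mat 1 1 (\<lambda>_. a)"
    \<comment> \<open>The factor is chosen so that the single entry of
      \<open>?M + ?L * B * ?G\<close> becomes -1.\<close>
    let ?G = "mat_of_cols m [(- (a + 1) / (\<beta> \<bullet> \<beta>)) \<cdot>\<^sub>v \<beta>]"
    show ?thesis
    proof (rule unstable_count_decrease[OF A B, of ?L 1 ?M ?G])
      show "?L * A = ?M * ?L"
        using A x by (subst mat_of_rows_mult[of _ n n]) (auto simp: Ax scalar_prod_def mat_of_rows_index intro!: eq_matI)
      have "a \<in> Eig ?M"
        unfolding Eig_iff_left_eigenvector[OF mat_carrier]
        by (intro bexI[of _ "vec 1 (\<lambda>_. 1)"]) (auto simp: vec_eq_iff scalar_prod_def)
      then show "\<not> stable_mat ?M" 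
        using z by (auto simp: stable_mat_def Eig_nonneg_def a_def)
      show "stable_mat (?M + ?L * B * ?G)"
        using p \<beta> x A B
        by (intro stable_mat_1; subst mat_of_rows_mult[OF B]) (auto simp: \<beta>_def[symmetric])
    qed auto
  next
    case False
    define \<beta> \<gamma> where "\<beta> = transpose_mat B *\<^sub>v u" and "\<gamma> = transpose_mat B *\<^sub>v v"
    have \<beta>: "\<beta> \<in> carrier_vec m" and \<gamma>: "\<gamma> \<in> carrier_vec m" using B uv by (auto simp: \<beta>_def \<gamma>_def)
    have "\<beta> \<noteq> 0\<^sub>v m \<or> \<gamma> \<noteq> 0\<^sub>v m"
    proof (rule ccontr)
      assume "\<not> (\<beta> \<noteq> 0\<^sub>v m \<or> \<gamma> \<noteq> 0\<^sub>v m)"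
      then have "map_vec Re (cmat (transpose_mat B) *\<^sub>v w) = 0\<^sub>v m"
        "map_vec Im (cmat (transpose_mat B) *\<^sub>v w) = 0\<^sub>v m"
        unfolding map_vec_Re_cmat_mult[OF B' w(1)] map_vec_Im_cmat_mult[OF B' w(1)]
        by (simp_all add: \<beta>_def \<gamma>_def u_def v_def)
      then have "cmat (transpose_mat B) *\<^sub>v w = 0\<^sub>v m"
        using B by (auto simp: vec_eq_iff complex_eq_iff)
      then show False
        using hautusD[OF h A B z w(1)] ev w by (simp add: cA cB)
    qed
    then have p: "\<beta> \<bullet> \<beta> + \<gamma> \<bullet> \<gamma> > 0"
      using scalar_prod_self_pos[OF \<beta>] scalar_prod_self_pos[OF \<gamma>]
      by (metis add_pos_pos add.right_neutral add.left_neutral scalar_prod_left_zero \<beta> \<gamma>)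
    have cs: "(\<beta> \<bullet> \<gamma>)\<^sup>2 \<le> (\<beta> \<bullet> \<beta>) * (\<gamma> \<bullet> \<gamma>)" by (rule real_cauchy_schwarz_vec[OF \<beta> \<gamma>])
    have comm: "\<gamma> \<bullet> \<beta> = \<beta> \<bullet> \<gamma>" by (rule comm_scalar_prod[OF \<gamma> \<beta>])
    \<comment> \<open>\<open>G L\<close> is the real part of \<open>(s + \<i> r) b\<^sup>* w\<close>, where \<open>b = \<beta> + \<i> \<gamma>\<close> and \<open>w = u + \<i> v\<close>.
      The scalar \<open>s\<close> makes the trace -1, and \<open>r\<close> cancels the term of the determinant that is
      linear in \<open>(s, r)\<close>.\<close>
    define s r where "s = - (2 * a + 1) / (\<beta> \<bullet> \<beta> + \<gamma> \<bullet> \<gamma>)" and "r = - a * s / b"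
    have sp: "s * (\<beta> \<bullet> \<beta> + \<gamma> \<bullet> \<gamma>) = - (2 * a + 1)" and br: "b * r = - a * s"
      using p False by (auto simp: s_def r_def)
    let ?L = "mat_of_rows n [u, v]"
    let ?M = "mat_of_rows_list 2 [[a, - b], [b, a]]"
    let ?G = "mat_of_cols m [s \<cdot>\<^sub>v \<beta> + r \<cdot>\<^sub>v \<gamma>, s \<cdot>\<^sub>v \<gamma> - r \<cdot>\<^sub>v \<beta>]"
    let ?F = "?M + ?L * B * ?G"
    have M: "?M \<in> carrier_mat 2 2" by (auto simp: mat_of_rows_list_def)
    have LB: "?L * B = mat_of_rows m [\<beta>, \<gamma>]"
      using uv by (subst mat_of_rows_mult[OF B]) (auto simp: \<beta>_def \<gamma>_def)
    have F: "?F $$ (0,0) = a + (s * (\<beta> \<bullet> \<beta>) + r * (\<beta> \<bullet> \<gamma>))"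
      "?F $$ (0,1) = - b + (s * (\<beta> \<bullet> \<gamma>) - r * (\<beta> \<bullet> \<beta>))"
      "?F $$ (1,0) = b + (s * (\<beta> \<bullet> \<gamma>) + r * (\<gamma> \<bullet> \<gamma>))"
      "?F $$ (1,1) = a + (s * (\<gamma> \<bullet> \<gamma>) - r * (\<beta> \<bullet> \<gamma>))"
      using \<beta> \<gamma> unfolding LB
      by (simp_all add: mat_of_rows_list_def scalar_prod_add_distrib[of _ m]
          scalar_prod_minus_distrib[of _ m] comm)
    show ?thesis
    proof (rule unstable_count_decrease[OF A B, of ?L 2 ?M ?G])
      show "?L * A = ?M * ?L"
        using A uv by (subst mat_of_rows_mult[of _ n n])
         (auto simp: Au Av scalar_prod_def mat_of_rows_index mat_of_rows_list_def numeral_2_eq_2 less_Suc_eq intro!: eq_matI)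
      \<comment> \<open>The witness has entries 1 and i, the coefficients of
        \<open>w = u + i v\<close> in the rows of \<open>?L\<close>.\<close>
      have "z \<in> Eig ?M"
        unfolding Eig_iff_left_eigenvector[OF M]
        by (intro bexI[of _ "vec 2 (\<lambda>i. if i = 0 then 1 else \<i>)"])
          (auto simp: vec_eq_iff scalar_prod_def mat_of_rows_list_def numeral_2_eq_2 less_Suc_eq
            complex_eq_iff a_def b_def)
      then show "\<not> stable_mat ?M" 
        using z by (auto simp: stable_mat_def Eig_nonneg_def)
      show "stable_mat ?F"
      proof (rule stable_mat_2)
        show "?F \<in> carrier_mat 2 2" using M B by auto
        have "?F $$ (0,0) + ?F $$ (1,1) = 2 * a + s * (\<beta> \<bullet> \<beta> + \<gamma> \<bullet> \<gamma>)"
          unfolding F by (simp add: algebra_simps)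
        then show "?F $$ (0,0) + ?F $$ (1,1) < 0" unfolding sp by simp
        \<comment> \<open>By the choice of \<open>r\<close> the middle term vanishes, and the last
          factor is a Gram determinant, nonnegative by Cauchy-Schwarz. Hence the determinant is at
          least that of \<open>?M\<close>.\<close>
        have "?F $$ (0,0) * ?F $$ (1,1) - ?F $$ (0,1) * ?F $$ (1,0)
          = a\<^sup>2 + b\<^sup>2 + (a * s + b * r) * (\<beta> \<bullet> \<beta> + \<gamma> \<bullet> \<gamma>)
            + (s\<^sup>2 + r\<^sup>2) * ((\<beta> \<bullet> \<beta>) * (\<gamma> \<bullet> \<gamma>) - (\<beta> \<bullet> \<gamma>)\<^sup>2)"
          unfolding F by (simp add: algebra_simps power2_eq_square)
        also have "\<dots> \<ge> a\<^sup>2 + b\<^sup>2" using cs br by simp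
        finally show "?F $$ (0,0) * ?F $$ (1,1) - ?F $$ (0,1) * ?F $$ (1,0) > 0"
          using False by (smt (verit) sum_power2_gt_zero_iff)
      qed
    qed (use M in auto)
  qed
qed

text \<open>Induction on \<open>unstable_count\<close>: while the matrix is not stable, some
  feedback lowers the count and preserves the Hautus condition. Successive feedbacks add up to a
  single one.\<close>

lemma hautus_imp_stabilizable:
  assumes "A \<in> carrier_mat n n" and B: "B \<in> carrier_mat n m" and "hautus A B"
  shows "stabilizable A B"
  using assms(1,3)
proof (induction "unstable_count A" arbitrary: A rule: less_induct)
  case less
  note A = \<open>A \<in> carrier_mat n n\<close>
  show ?case
  proof (cases "stable_mat A")
    case True
    have "A + B * 0\<^sub>m m n = A" using A B by auto
    then show ?thesis
      unfolding stabilizable_def using True A B by (intro bexI[of _ "0\<^sub>m m n"]) auto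
  next
    case False
    obtain K where K: "K \<in> carrier_mat m n" "unstable_count (A + B * K) < unstable_count A"
      using feedback_decreasing_unstable_count[OF A B _ False] less.prems by blast
    have AK: "A + B * K \<in> carrier_mat n n" using A B K by auto
    have "stabilizable (A + B * K) B"
      using less.hyps[OF K(2) AK] hautus_feedback[OF A B K(1)] less.prems by blast
    then obtain K' where K': "K' \<in> carrier_mat m n" "stable_mat (A + B * K + B * K')"
      unfolding stabilizable_def using A B by auto
    have "A + B * K + B * K' = A + B * (K + K')"
      using A B K K' by (auto simp: mult_add_distrib_mat[of _ n m] assoc_add_mat[of _ n n])
    then show ?thesis
      unfolding stabilizable_def using K' K A B by (intro bexI[of _ "K + K'"]) auto
  qed
qed

lemma stabilizable_iff_hautus:
  assumes "A \<in> carrier_mat n n" "B \<in> carrier_mat n m"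
  shows "stabilizable A B \<longleftrightarrow> hautus A B"
  using stabilizable_imp_hautus hautus_imp_stabilizable assms by blast

subsection \<open>Block vectors and ensembles\<close>

fun concat_vec :: "'a vec list \<Rightarrow> 'a vec" where
  "concat_vec [] = vNil"
| "concat_vec (w # ws) = w @\<^sub>v concat_vec ws"

lemma concat_vec_carrier [simp]:
  "set ws \<subseteq> carrier_vec n \<Longrightarrow> concat_vec ws \<in> carrier_vec (length ws * n)"
  by (induction ws) auto

lemma concat_vec_surj:
  "x \<in> carrier_vec (N * n) \<Longrightarrow> \<exists>ws. length ws = N \<and> set ws \<subseteq> carrier_vec n \<and> x = concat_vec ws"
proof (induction N arbitrary: x)
  case (Suc N)
  then have x: "x \<in> carrier_vec (n + N * n)" by simp
  obtain ws where ws: "length ws = N" "set ws \<subseteq> carrier_vec n" "vec_last x (N * n) = concat_vec ws"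
    using Suc.IH[of "vec_last x (N * n)"] by auto
  have "x = concat_vec (vec_first x n # ws)"
    using vec_first_last_append[OF x] ws by simp
  then show ?case using ws by (intro exI[of _ "vec_first x n # ws"]) auto
qed auto

text \<open>All blocks have the same length \<open>n\<close>, so the block boundaries on both sides
  agree.\<close>

lemma concat_vec_inject:
  assumes "length vs = length ws" "set vs \<subseteq> carrier_vec n" "set ws \<subseteq> carrier_vec n"
  shows "concat_vec vs = concat_vec ws \<longleftrightarrow> vs = ws"
  using assms
proof (induction vs ws rule: list_induct2)
  case (Cons v vs w ws)
  then show ?case by (auto simp: append_vec_eq[of v n w])
qed simp

lemma smult_concat_vec: "c \<cdot>\<^sub>v concat_vec ws = concat_vec (map (\<lambda>w. c \<cdot>\<^sub>v w) ws)"
proof (induction ws)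
  case (Cons w ws)
  have "c \<cdot>\<^sub>v (w @\<^sub>v concat_vec ws) = (c \<cdot>\<^sub>v w) @\<^sub>v (c \<cdot>\<^sub>v concat_vec ws)"
    by (intro eq_vecI) auto
  with Cons show ?case by simp
qed (auto intro!: eq_vecI)

lemma zero_vec_concat: "(0\<^sub>v (N * n) :: 'a :: zero vec) = concat_vec (replicate N (0\<^sub>v n))"
proof (induction N)
  case (Suc N)
  have "(0\<^sub>v (Suc N * n) :: 'a vec) = 0\<^sub>v n @\<^sub>v 0\<^sub>v (N * n)" by (intro eq_vecI) auto
  also have "\<dots> = concat_vec (replicate (Suc N) (0\<^sub>v n))"
    unfolding Suc.IH by simp
  finally show ?case .
qed (auto intro!: eq_vecI)

section \<open>Block-diagonal and stacked matrices\<close>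

lemma diag_block_mat_carrier:
  assumes "set As \<subseteq> carrier_mat n n"
  shows "diag_block_mat As \<in> carrier_mat (length As * n) (length As * n)"
  using assms by (induction As) (auto simp: Let_def)

text \<open>The off-diagonal blocks remain zero under transposition, so each component meets only
  its own matrix.\<close>

lemma transpose_diag_block_mat_mult_vec:
  fixes As :: "'a :: comm_semiring_0 mat list"
  assumes "length As = length ws" "set As \<subseteq> carrier_mat n n" "set ws \<subseteq> carrier_vec n"
  shows "transpose_mat (diag_block_mat As) *\<^sub>v concat_vec ws
    = concat_vec (map2 (\<lambda>A w. transpose_mat A *\<^sub>v w) As ws)"
  using assms
proof (induction As ws rule: list_induct2)
  case (Cons A As w ws)
  let ?D = "diag_block_mat As" and ?k = "length As * n"
  have A: "A \<in> carrier_mat n n" and D: "?D \<in> carrier_mat ?k ?k"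
    and w: "w \<in> carrier_vec n" and ws: "concat_vec ws \<in> carrier_vec ?k"
    using Cons diag_block_mat_carrier[of As n] by auto
  have "transpose_mat (diag_block_mat (A # As)) = 
      four_block_mat (transpose_mat A) (0\<^sub>m n ?k) (0\<^sub>m ?k n) (transpose_mat ?D)"
    using A D by (simp add: Let_def transpose_four_block_mat[of A n n "0\<^sub>m n ?k" ?k "0\<^sub>m ?k n" ?k ?D])
  then show ?case
    using Cons mult_mat_vec_split[of "transpose_mat A" n "transpose_mat ?D" ?k w "concat_vec ws"] A D w ws
    by simp
qed (auto intro!: eq_vecI)

lemma stack_copies_carrier:
  "B \<in> carrier_mat n m \<Longrightarrow> stack_copies N B \<in> carrier_mat (N * n) m"
  unfolding stack_copies_def by (auto simp: length_concat sum_list_replicate)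

lemma stack_copies_0: "stack_copies 0 B = 0\<^sub>m 0 (dim_col B)"
  unfolding stack_copies_def by (intro eq_matI) auto

lemma stack_copies_Suc: "stack_copies (Suc N) B = B @\<^sub>r stack_copies N B"
  unfolding stack_copies_def append_rows_def
  by (intro eq_matI) (auto simp: mat_of_rows_index nth_append length_concat sum_list_replicate)

text \<open>The transposed stack is a row of copies of the transpose of \<open>B\<close>, so it adds
  up the images of the blocks. Working per coordinate keeps the sum among scalars instead of vectors
  of a fixed dimension.\<close>

lemma transpose_stack_copies_mult_vec:
  fixes B :: "'a :: comm_semiring_0 mat"
  assumes B: "B \<in> carrier_mat n m" and "set ws \<subseteq> carrier_vec n" and k: "k < m"
  shows "(transpose_mat (stack_copies (length ws) B) *\<^sub>v concat_vec ws) $ k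
    = (\<Sum>w\<leftarrow>ws. (transpose_mat B *\<^sub>v w) $ k)"
  using assms(2)
proof (induction ws)
  case (Cons w ws)
  let ?S = "stack_copies (length ws) B" and ?l = "length ws * n"
  have S: "?S \<in> carrier_mat ?l m" and w: "w \<in> carrier_vec n" and ws: "concat_vec ws \<in> carrier_vec ?l"
    using Cons stack_copies_carrier[OF B] by auto
  \<comment> \<open>Appending rows is a four-block matrix whose right-hand blocks have width 0,
    hence the 0 among the dimensions.\<close>
  have "col (B @\<^sub>r ?S) k = col B k @\<^sub>v col ?S k"
    unfolding append_rows_def using B S k 
    by (intro col_four_block_mat(1)[of _ n m _ 0 _ ?l]) auto
  then have "(transpose_mat (B @\<^sub>r ?S) *\<^sub>v (w @\<^sub>v concat_vec ws)) $ k
      = (col B k @\<^sub>v col ?S k) \<bullet> (w @\<^sub>v concat_vec ws)"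
    using carrier_append_rows[OF B S] k by simp
  also have "\<dots> = col B k \<bullet> w + col ?S k \<bullet> concat_vec ws"
    using B S k w ws by (intro scalar_prod_append) auto
  finally show ?case
    using Cons B S k by (simp add: stack_copies_Suc)
qed (use B k in \<open>auto simp: stack_copies_0\<close>)

lemma cmat_diag_block_mat: "cmat (diag_block_mat As) = diag_block_mat (map cmat As)"
proof (induction As)
  case (Cons A As)
  then show ?case 
    by (simp add: Let_def flip: Cons.IH) (intro eq_matI; auto)
qed auto

lemma cmat_stack_copies: "cmat (stack_copies N B) = stack_copies N (cmat B)"
proof (induction N)
  case (Suc N)
  have "dim_col (stack_copies N B) = dim_col B" by (simp add: stack_copies_def)
  then show ?case
    unfolding stack_copies_Suc append_rows_def Suc.IH[symmetric] by (intro eq_matI) auto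
qed (auto simp: stack_copies_0)

section \<open>The Hautus test for ensembles\<close>

text \<open>Cutting a vector into blocks decouples the eigenvector equation; the members interact
  only through the sum coming from the stacked input matrix. Blocks are indexed by a function so
  that tuples can later be given by case distinction.\<close>

lemma hautus_ensemble_iff:
  assumes B: "B \<in> carrier_mat n m" and As: "set As \<subseteq> carrier_mat n n"
  shows "hautus (diag_block_mat As) (stack_copies (length As) B) \<longleftrightarrow>
    (\<forall>z w. Re z \<ge> 0 \<longrightarrow> (\<forall>i<length As. w i \<in> carrier_vec n) \<longrightarrow>
       (\<forall>i<length As. transpose_mat (cmat (As ! i)) *\<^sub>v w i = z \<cdot>\<^sub>v w i) \<longrightarrow>
       (\<forall>k<m. (\<Sum>i<length As. (transpose_mat (cmat B) *\<^sub>v w i) $ k) = 0) \<longrightarrow>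
       (\<forall>i<length As. w i = 0\<^sub>v n))" (is "?h \<longleftrightarrow> ?c")
proof -
  let ?N = "length As" and ?D = "diag_block_mat As" and ?S = "stack_copies (length As) B"
  have D: "?D \<in> carrier_mat (?N * n) (?N * n)" using diag_block_mat_carrier[OF As] .
  have S: "?S \<in> carrier_mat (?N * n) m" using stack_copies_carrier[OF B] .
  have cB: "cmat B \<in> carrier_mat n m" using B by auto
  have cAs: "set (map cmat As) \<subseteq> carrier_mat n n" using As by auto
  have eig: "transpose_mat (cmat ?D) *\<^sub>v concat_vec ws = z \<cdot>\<^sub>v concat_vec ws \<longleftrightarrow>
      (\<forall>i<?N. transpose_mat (cmat (As ! i)) *\<^sub>v ws ! i = z \<cdot>\<^sub>v ws ! i)"
    and ker: "transpose_mat (cmat ?S) *\<^sub>v concat_vec ws = 0\<^sub>v m \<longleftrightarrow>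
      (\<forall>k<m. (\<Sum>i<?N. (transpose_mat (cmat B) *\<^sub>v ws ! i) $ k) = 0)"
    and zero: "concat_vec ws = 0\<^sub>v (?N * n) \<longleftrightarrow> (\<forall>i<?N. ws ! i = 0\<^sub>v n)"
    if ws: "length ws = ?N" "set ws \<subseteq> carrier_vec n" for ws z
  proof -
    have Tws: "set (map2 (\<lambda>A w. transpose_mat A *\<^sub>v w) (map cmat As) ws) \<subseteq> carrier_vec n"
    proof -
      have "transpose_mat (cmat A) *\<^sub>v w \<in> carrier_vec n" if "A \<in> set As" for A w
      proof -
        have "A \<in> carrier_mat n n" using As that by blast
        then show ?thesis by (intro carrier_vecI) simp
      qed
      then show ?thesis by (auto simp: set_zip)
    qed
    have "transpose_mat (cmat ?D) *\<^sub>v concat_vec ws 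
        = concat_vec (map2 (\<lambda>A w. transpose_mat A *\<^sub>v w) (map cmat As) ws)"
      unfolding cmat_diag_block_mat
      by (intro transpose_diag_block_mat_mult_vec[of _ _ n]) (use ws cAs in auto)
    also have "\<dots> = z \<cdot>\<^sub>v concat_vec ws \<longleftrightarrow>
      (\<forall>i<?N. transpose_mat (cmat (As ! i)) *\<^sub>v ws ! i = z \<cdot>\<^sub>v ws ! i)"
      unfolding smult_concat_vec using ws Tws
      by (subst concat_vec_inject[of _ _ n]) (auto simp: list_eq_iff_nth_eq)
    finally show "transpose_mat (cmat ?D) *\<^sub>v concat_vec ws = z \<cdot>\<^sub>v concat_vec ws \<longleftrightarrow>
      (\<forall>i<?N. transpose_mat (cmat (As ! i)) *\<^sub>v ws ! i = z \<cdot>\<^sub>v ws ! i)" .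
    define y where "y = transpose_mat (cmat ?S) *\<^sub>v concat_vec ws"
    have "y $ k = (\<Sum>i<?N. (transpose_mat (cmat B) *\<^sub>v ws ! i) $ k)" if "k < m" for k
      unfolding y_def cmat_stack_copies ws(1)[symmetric] transpose_stack_copies_mult_vec[OF cB ws(2) that]
      by (simp add: sum_list_sum_nth atLeast0LessThan)
    moreover have "dim_vec y = m" using S by (simp add: y_def)
    ultimately show "transpose_mat (cmat ?S) *\<^sub>v concat_vec ws = 0\<^sub>v m \<longleftrightarrow>
      (\<forall>k<m. (\<Sum>i<?N. (transpose_mat (cmat B) *\<^sub>v ws ! i) $ k) = 0)"
      unfolding y_def[symmetric] by (auto simp: vec_eq_iff)
    have "concat_vec ws = 0\<^sub>v (?N * n) \<longleftrightarrow> ws = replicate ?N (0\<^sub>v n)"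
      unfolding zero_vec_concat by (rule concat_vec_inject[of _ _ n]) (use ws in auto)
    then show "concat_vec ws = 0\<^sub>v (?N * n) \<longleftrightarrow> (\<forall>i<?N. ws ! i = 0\<^sub>v n)"
      using ws by (simp add: list_eq_iff_nth_eq)
  qed
  have dims: "dim_row ?D = ?N * n" "dim_col ?S = m" using D S by auto
  show ?thesis
  proof
    assume h: ?h
    show ?c
    proof (intro allI impI, goal_cases)
      case (1 z w i)
      let ?ws = "map w [0..<?N]"
      have ws: "length ?ws = ?N" "set ?ws \<subseteq> carrier_vec n" using 1 by auto
      have "concat_vec ?ws = 0\<^sub>v (?N * n)"
        using 1 ws concat_vec_carrier[OF ws(2)]
        by (intro hautusD[OF h D S, of z] eig[OF ws, THEN iffD2] ker[OF ws, THEN iffD2]) auto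
      then show ?case using zero[OF ws] 1 by simp
    qed
  next
    assume c: ?c
    show ?h
      unfolding hautus_def dims
    proof (intro allI impI, goal_cases)
      case (1 z x)
      obtain ws where ws: "length ws = ?N" "set ws \<subseteq> carrier_vec n" and x: "x = concat_vec ws"
        using concat_vec_surj[OF 1(2)] by auto
      have "\<forall>i<?N. ws ! i \<in> carrier_vec n" using ws by (metis nth_mem subsetD)
      then have "\<forall>i<?N. ws ! i = 0\<^sub>v n"
        using c[rule_format, of z "(!) ws"] 1 ws unfolding x eig[OF ws] ker[OF ws] by blast
      then show ?case unfolding x zero[OF ws] .
    qed
  qed
qed

text \<open>Writing the \<open>m + 1\<close> vectors as columns and padding with a zero row gives a
  singular square matrix; a kernel vector supplies the coefficients. An indexed family allows
  repeated vectors.\<close>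

lemma nontrivial_linear_relation:
  fixes y :: "'i \<Rightarrow> nat \<Rightarrow> 'a :: idom"
  assumes "finite I" and "card I = Suc m"
  shows "\<exists>c. (\<exists>i\<in>I. c i \<noteq> 0) \<and> (\<forall>k<m. (\<Sum>i\<in>I. c i * y i k) = 0)"
proof -
  obtain e where e: "bij_betw e {0..<Suc m} I"
    using ex_bij_betw_nat_finite[OF assms(1)] assms(2) by auto
  define C where "C = mat (Suc m) (Suc m) (\<lambda>(k, l). if k < m then y (e l) k else 0)"
  have C: "C \<in> carrier_mat (Suc m) (Suc m)" by (simp add: C_def)
  \<comment> \<open>Row \<open>m\<close> of \<open>C\<close> is the zero padding, so the transpose
    annihilates the last unit vector.\<close>
  have "transpose_mat C *\<^sub>v unit_vec (Suc m) m = 0\<^sub>v (Suc m)"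
    by (intro eq_vecI) (auto simp: C_def)
  then have "det (transpose_mat C) = 0"
    using C by (subst det_0_iff_vec_prod_zero[of _ "Suc m"]) (auto intro!: exI[of _ "unit_vec (Suc m) m"])
  then have "det C = 0" using det_transpose[OF C] by simp
  then obtain v where v: "v \<in> carrier_vec (Suc m)" "v \<noteq> 0\<^sub>v (Suc m)" "C *\<^sub>v v = 0\<^sub>v (Suc m)"
    using det_0_iff_vec_prod_zero[OF C] by auto
  define c where "c i = v $ inv_into {0..<Suc m} e i" for i
  have ce: "c (e l) = v $ l" if "l < Suc m" for l
    using that e unfolding c_def by (simp add: bij_betw_inv_into_left)
  obtain l where l: "l < Suc m" "v $ l \<noteq> 0" using v(1,2) by (auto simp: vec_eq_iff)
  have "(\<Sum>i\<in>I. c i * y i k) = 0" if "k < m" for k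
  proof -
    have "(\<Sum>i\<in>I. c i * y i k) = (\<Sum>l\<in>{0..<Suc m}. c (e l) * y (e l) k)"
      by (rule sum.reindex_bij_betw[OF e, symmetric])
    also have "\<dots> = (\<Sum>l\<in>{0..<Suc m}. C $$ (k, l) * v $ l)"
      using that by (intro sum.cong) (auto simp: ce C_def)
    also have "\<dots> = (C *\<^sub>v v) $ k"
      using that v(1) C by (auto simp: scalar_prod_def intro!: sum.cong)
    also have "\<dots> = 0" using v(3) that by simp
    finally show ?thesis .
  qed
  moreover have "e l \<in> I" using l(1) e by (auto simp: bij_betw_def)
  ultimately show ?thesis using ce[OF l(1)] l(2) by metis
qed

lemma ensemble_stabilizable_iff:
  assumes B: "B \<in> carrier_mat n m" and As: "set As \<subseteq> carrier_mat n n"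
  shows "ensemble_stabilizable As B \<longleftrightarrow>
    (\<forall>z w. Re z \<ge> 0 \<longrightarrow> (\<forall>i<length As. w i \<in> carrier_vec n) \<longrightarrow>
       (\<forall>i<length As. transpose_mat (cmat (As ! i)) *\<^sub>v w i = z \<cdot>\<^sub>v w i) \<longrightarrow>
       (\<forall>k<m. (\<Sum>i<length As. (transpose_mat (cmat B) *\<^sub>v w i) $ k) = 0) \<longrightarrow>
       (\<forall>i<length As. w i = 0\<^sub>v n))"
  unfolding ensemble_stabilizable_def hautus_ensemble_iff[OF B As, symmetric]
  by (rule stabilizable_iff_hautus[OF diag_block_mat_carrier[OF As] stack_copies_carrier[OF B]])

lemma Eig_nonneg_iff_left_eigenvector:
  assumes "A \<in> carrier_mat n n"
  shows "z \<in> Eig_nonneg A \<longleftrightarrow> Re z \<ge> 0 \<and>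
    (\<exists>w \<in> carrier_vec n. w \<noteq> 0\<^sub>v n \<and> transpose_mat (cmat A) *\<^sub>v w = z \<cdot>\<^sub>v w)"
  unfolding Eig_nonneg_def using Eig_iff_left_eigenvector[OF assms] by auto

section \<open>Necessary and sufficient conditions for ensembles\<close>

text \<open>A vector violating the Hautus condition of one member, padded with zeros, would violate
  that of the ensemble.\<close>

lemma ensemble_stabilizable_imp_stabilizable:
  assumes B: "B \<in> carrier_mat n m" and As: "set As \<subseteq> carrier_mat n n"
    and ens: "ensemble_stabilizable As B" and i: "i < length As"
  shows "stabilizable (As ! i) B"
proof -
  have Ai: "As ! j \<in> carrier_mat n n" if "j < length As" for j using As that by auto
  have "hautus (As ! i) B"
    unfolding hautus_def
  proof (intro allI impI, goal_cases)
    case (1 z x)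
    let ?w = "\<lambda>j. if j = i then x else 0\<^sub>v n"
    have x: "x \<in> carrier_vec n" using 1 Ai[OF i] by auto
    have "(\<Sum>j<length As. (transpose_mat (cmat B) *\<^sub>v ?w j) $ k) = 0" if "k < m" for k
    proof -
      have "(transpose_mat (cmat B) *\<^sub>v ?w j) $ k = 0" for j
        using 1(4) B that by (cases "j = i") auto
      then show ?thesis by simp
    qed
    moreover have "transpose_mat (cmat (As ! j)) *\<^sub>v ?w j = z \<cdot>\<^sub>v ?w j" if "j < length As" for j
      using 1(3) Ai[OF that] by (cases "j = i") (auto intro!: eq_vecI)
    ultimately have "?w i = 0\<^sub>v n"
      using ens[unfolded ensemble_stabilizable_iff[OF B As], rule_format, of z ?w i] 1(1) x i by auto
    then show ?case using Ai[OF i] by simp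
  qed
  then show ?thesis using hautus_imp_stabilizable[OF Ai[OF i] B] by simp
qed

lemma ensemble_stabilizable_imp_common_Eig_empty:
  assumes B: "B \<in> carrier_mat n m" and As: "set As \<subseteq> carrier_mat n n"
    and ens: "ensemble_stabilizable As B"
    and J: "J \<subseteq> {..<length As}" "card J = Suc m"
  shows "(\<Inter>j\<in>J. Eig_nonneg (As ! j)) = {}"
proof (rule ccontr)
  assume "\<not> ?thesis"
  then obtain z where z: "\<And>j. j \<in> J \<Longrightarrow> z \<in> Eig_nonneg (As ! j)" by auto
  have Ai: "As ! j \<in> carrier_mat n n" if "j < length As" for j using As that by auto
  have "\<forall>j\<in>J. Re z \<ge> 0 \<and> (\<exists>w \<in> carrier_vec n. w \<noteq> 0\<^sub>v n \<and> transpose_mat (cmat (As ! j)) *\<^sub>v w = z \<cdot>\<^sub>v w)"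
    using z J(1) Eig_nonneg_iff_left_eigenvector[OF Ai] by (auto simp: subset_iff)
  then obtain x where x: "\<And>j. j \<in> J \<Longrightarrow> x j \<in> carrier_vec n" "\<And>j. j \<in> J \<Longrightarrow> x j \<noteq> 0\<^sub>v n"
     "\<And>j. j \<in> J \<Longrightarrow> transpose_mat (cmat (As ! j)) *\<^sub>v x j = z \<cdot>\<^sub>v x j" and "J \<noteq> {} \<Longrightarrow> Re z \<ge> 0"
    by (metis all_not_in_conv)
  \<comment> \<open>The sign of \<open>Re z\<close> is known only through some member of
    \<open>J\<close>. The cardinality \<open>Suc m\<close> provides one even for
    \<open>m = 0\<close>, and it forces finiteness since infinite sets have \<open>card\<close>
    0.\<close>
  have "J \<noteq> {}" using J(2) by auto
  then have Re: "Re z \<ge> 0" by fact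
  have fin: "finite J" using J(2) card.infinite by fastforce
  let ?y = "\<lambda>j k. (transpose_mat (cmat B) *\<^sub>v x j) $ k"
  obtain c j where c: "\<And>k. k < m \<Longrightarrow> (\<Sum>i\<in>J. c i * ?y i k) = 0" and j: "j \<in> J" "c j \<noteq> 0"
    using nontrivial_linear_relation[OF fin J(2), of ?y] by auto
  \<comment> \<open>Scaling the eigenvectors by the coefficients of the relation makes their images
    under the transpose of \<open>B\<close> cancel.\<close>
  let ?w = "\<lambda>i. if i \<in> J then c i \<cdot>\<^sub>v x i else 0\<^sub>v n"
  have "(\<Sum>i<length As. (transpose_mat (cmat B) *\<^sub>v ?w i) $ k) = 0" if k: "k < m" for k
  proof -
    have "(\<Sum>i<length As. (transpose_mat (cmat B) *\<^sub>v ?w i) $ k) = (\<Sum>i\<in>J. (transpose_mat (cmat B) *\<^sub>v ?w i) $ k)"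
      using J(1) B k by (intro sum.mono_neutral_right) auto
    also have "\<dots> = (\<Sum>i\<in>J. c i * ?y i k)"
      using B k x(1) by (intro sum.cong) (auto simp: mult_mat_vec[of _ m n])
    finally show ?thesis using c[OF k] by simp
  qed
  moreover have "transpose_mat (cmat (As ! i)) *\<^sub>v ?w i = z \<cdot>\<^sub>v ?w i" if "i < length As" for i
    using x Ai[OF that]
    by (cases "i \<in> J") (auto simp: mult_mat_vec[of _ n n] smult_smult_assoc mult.commute intro!: eq_vecI)
  ultimately have "?w j = 0\<^sub>v n"
    using ens[unfolded ensemble_stabilizable_iff[OF B As], rule_format, of z ?w j] Re x(1) j(1) J(1) by auto
  then show False using j x(1,2)[OF j(1)] by (auto simp: vec_eq_iff)
qed

text \<open>Every nonzero component makes \<open>z\<close> an unstable eigenvalue of its member, so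
  at most one is nonzero. The sum then has a single term, and the Hautus condition of that member
  applies.\<close>

lemma disjoint_Eig_imp_ensemble_stabilizable:
  assumes B: "B \<in> carrier_mat n m" and As: "set As \<subseteq> carrier_mat n n"
    and st: "\<And>i. i < length As \<Longrightarrow> stabilizable (As ! i) B"
    and disj: "\<And>i j. i < length As \<Longrightarrow> j < length As \<Longrightarrow> i \<noteq> j \<Longrightarrow> Eig_nonneg (As ! i) \<inter> Eig_nonneg (As ! j) = {}"
  shows "ensemble_stabilizable As B"
  unfolding ensemble_stabilizable_iff[OF B As]
proof (intro allI impI, goal_cases)
  case (1 z w i)
  have Ai: "As ! j \<in> carrier_mat n n" if "j < length As" for j using As that by auto
  show ?case
  proof (rule ccontr)
    assume nz: "w i \<noteq> 0\<^sub>v n"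
    have "z \<in> Eig_nonneg (As ! j)" if "j < length As" "w j \<noteq> 0\<^sub>v n" for j
      using 1 that Eig_nonneg_iff_left_eigenvector[OF Ai[OF that(1)]] by auto
    then have others: "w j = 0\<^sub>v n" if "j < length As" "j \<noteq> i" for j
      using disj[OF that(1) 1(5) that(2)] nz that 1(5) by auto
    have "(transpose_mat (cmat B) *\<^sub>v w i) $ k = 0" if k: "k < m" for k
    proof -
      have "(\<Sum>j<length As. (transpose_mat (cmat B) *\<^sub>v w j) $ k) = (\<Sum>j\<in>{i}. (transpose_mat (cmat B) *\<^sub>v w j) $ k)"
        using 1(5) B k others by (intro sum.mono_neutral_right) auto
      then show ?thesis using 1(4) k by simp
    qed
    then have "transpose_mat (cmat B) *\<^sub>v w i = 0\<^sub>v m"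
      using B by (intro eq_vecI) auto
    then have "w i = 0\<^sub>v n"
      using hautusD[OF stabilizable_imp_hautus[OF Ai[OF 1(5)] B st[OF 1(5)]] Ai[OF 1(5)] B 1(1), of "w i"] 1 by auto
    with nz show False ..
  qed
qed

theorem lemma2p6:
  fixes N n m :: nat
    and \<sigma> :: "nat \<Rightarrow> 'p"
    and A :: "'p \<Rightarrow> real mat"
    and B :: "real mat"
  assumes "N \<ge> 2"
    and "\<And>i. i \<in> {1..N} \<Longrightarrow> A (\<sigma> i) \<in> carrier_mat n n"
    and "B \<in> carrier_mat n m"
  shows
    "(ensemble_stabilizable (map (\<lambda>i. A (\<sigma> i)) [1..<Suc N]) B \<longrightarrow>
        (\<forall>i\<in>{1..N}. stabilizable (A (\<sigma> i)) B) \<and>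
        (\<Union>I \<in> {I. I \<subseteq> {1..N} \<and> card I = m + 1}. \<Inter>j\<in>I. Eig_nonneg (A (\<sigma> j))) = {})
     \<and>
     ((\<forall>i\<in>{1..N}. stabilizable (A (\<sigma> i)) B) \<and>
      (\<forall>i\<in>{1..N}. \<forall>j\<in>{1..N}. i \<noteq> j \<longrightarrow>
          Eig_nonneg (A (\<sigma> i)) \<inter> Eig_nonneg (A (\<sigma> j)) = {}) \<longrightarrow>
      ensemble_stabilizable (map (\<lambda>i. A (\<sigma> i)) [1..<Suc N]) B)"
proof (intro conjI impI)
  let ?As = "map (\<lambda>i. A (\<sigma> i)) [1..<Suc N]"
  note B = assms(3)
  have As: "set ?As \<subseteq> carrier_mat n n" using assms(2) by auto
  have len: "length ?As = N" by simp
  \<comment> \<open>Parameters are numbered from 1, list positions from 0.\<close>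
  have nth: "?As ! i = A (\<sigma> (Suc i))" if "i < N" for i
    using that by (simp del: upt_Suc)
  {
    assume ens: "ensemble_stabilizable ?As B"
    show "\<forall>i\<in>{1..N}. stabilizable (A (\<sigma> i)) B"
    proof
      fix i assume i: "i \<in> {1..N}"
      then have "i - 1 < N" "Suc (i - 1) = i" by auto
      then show "stabilizable (A (\<sigma> i)) B"
        using ensemble_stabilizable_imp_stabilizable[OF B As ens, of "i - 1"] nth[of "i - 1"] len by metis
    qed
    have "(\<Inter>j\<in>I. Eig_nonneg (A (\<sigma> j))) = {}" if I: "I \<subseteq> {1..N}" "card I = m + 1" for I
    proof -
      \<comment> \<open>The index set moved to list positions. Truncated subtraction loses nothing
        because 0 is not in \<open>I\<close>.\<close>
      let ?J = "(\<lambda>i. i - 1) ` I"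
      have I_eq: "I = Suc ` ?J"
        using I(1) by (force simp: image_image)
      have J: "?J \<subseteq> {..<N}" using I(1) by fastforce
      have "card ?J = card (Suc ` ?J)" by (simp add: card_image)
      then have "card ?J = Suc m" using I(2) I_eq by simp
      then have "(\<Inter>j\<in>?J. Eig_nonneg (?As ! j)) = {}"
        by (intro ensemble_stabilizable_imp_common_Eig_empty[OF B As ens]) (use J len in auto)
      moreover have "(\<Inter>j\<in>I. Eig_nonneg (A (\<sigma> j))) = (\<Inter>j\<in>?J. Eig_nonneg (A (\<sigma> (Suc j))))"
        by (subst I_eq) (simp only: image_image)
      moreover have "\<dots> = (\<Inter>j\<in>?J. Eig_nonneg (?As ! j))"
        using J nth by (intro INF_cong refl) (metis lessThan_iff subsetD)
      ultimately show ?thesis by simp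
    qed
    then show "(\<Union>I \<in> {I. I \<subseteq> {1..N} \<and> card I = m + 1}. \<Inter>j\<in>I. Eig_nonneg (A (\<sigma> j))) = {}"
      by blast
  }
  assume h: "(\<forall>i\<in>{1..N}. stabilizable (A (\<sigma> i)) B) \<and>
      (\<forall>i\<in>{1..N}. \<forall>j\<in>{1..N}. i \<noteq> j \<longrightarrow> Eig_nonneg (A (\<sigma> i)) \<inter> Eig_nonneg (A (\<sigma> j)) = {})"
  show "ensemble_stabilizable ?As B"
    by (rule disjoint_Eig_imp_ensemble_stabilizable[OF B As]; unfold len)
      (use h in \<open>auto simp: nth simp del: upt_Suc\<close>)
qed

end
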